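(* Let $n,s$ be integers with $1\le s<n-1$, let $x=(x_1,\dots,x_n)\in\mathbb{R}^n$ and $\alpha=(\alpha_1,\dots,\alpha_s)\in\mathbb{R}^s$. Suppose that the polynomial $f(t)=t^s+\alpha_1t^{s-1}+\alpha_2t^{s-2}+\cdots+\alpha_s$ has only real roots, and denote these roots (with multiplicity) by $-\beta_1,-\beta_2,\dots,-\beta_s$. Then $$S_{k;s}(x)^2\ \ge\ S_{k-1;s}(x)\,S_{k+1;s}(x),\qquad k=s+1,\dots,n-1.$$ Each of these inequalities is strict unless $n$ of the $n+s$ elements $x_1,x_2,\dots,x_n,-\beta_1,-\beta_2,\dots,-\beta_s$ are equal or both sides of the inequality are zero.
   Context: For $x=(x_1,\dots,x_n)\in\mathbb{R}^n$, $\sigma_k(x)=\sum_{1\le i_1<\cdots<i_k\le n}x_{i_1}\cdots x_{i_k}$ for $1\le k\le n$ is the $k$-th elementary symmetric function, with $\sigma_0(x)=1$ and $\sigma_k(x)=0$ for $k<0$ or $k>n$. The $k$-th elementary symmetric mean is $E_k(x)=\sigma_k(x)/C_n^k$ for $k=0,1,\dots,n$, where $C_n^k=\frac{n!}{k!(n-k)!}$. For $\alpha=(\alpha_1,\dots,\alpha_s)\in\mathbb{R}^s$, define $$S_{k;s}(x)=E_k(x)+\sum_{i=1}^s\alpha_iE_{k-i}(x).$$ *)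

theory Defs
  imports "HOL-Computational_Algebra.Computational_Algebra" "HOL.Complex"
begin

text \<open>
  A vector of \<open>\<real>\<^sup>n\<close> is a function \<open>x :: nat \<Rightarrow> real\<close> of which only the values on
  \<open>{1..n}\<close> matter. The order \<open>k\<close> is an integer, so that the convention
  \<open>\<sigma>\<^sub>k(x) = 0\<close> for \<open>k < 0\<close> or \<open>k > n\<close> holds without truncated subtraction: no subset
  of \<open>{1..n}\<close> has such a cardinality, and the sum is empty.
\<close>

definition elem_sym :: "nat \<Rightarrow> (nat \<Rightarrow> real) \<Rightarrow> int \<Rightarrow> real" where
  "elem_sym n x k = (\<Sum>I | I \<subseteq> {1..n} \<and> int (card I) = k. \<Prod>i\<in>I. x i)"

text \<open>For \<open>k < 0\<close> or \<open>k > n\<close> the numerator vanishes, hence so does the mean.\<close>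

definition elem_mean :: "nat \<Rightarrow> (nat \<Rightarrow> real) \<Rightarrow> int \<Rightarrow> real" where
  "elem_mean n x k = elem_sym n x k / real (n choose nat k)"

definition S_mean :: "nat \<Rightarrow> nat \<Rightarrow> (nat \<Rightarrow> real) \<Rightarrow> (nat \<Rightarrow> real) \<Rightarrow> int \<Rightarrow> real" where
  "S_mean n s \<alpha> x k = elem_mean n x k + (\<Sum>i=1..s. \<alpha> i * elem_mean n x (k - int i))"

definition assoc_poly :: "nat \<Rightarrow> (nat \<Rightarrow> real) \<Rightarrow> real poly" where
  "assoc_poly s \<alpha> = monom 1 s + (\<Sum>i=1..s. monom (\<alpha> i) (s - i))"

definition only_real_roots :: "real poly \<Rightarrow> bool" where
  "only_real_roots p \<longleftrightarrow> (\<forall>z::complex. poly (map_poly complex_of_real p) z = 0 \<longrightarrow> z \<in> \<real>)"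

end

theory Submission
  imports Defs
begin

text \<open>
  Encode the numbers \<open>E\<^sub>0(x), \<dots>, E\<^sub>n(x)\<close> in the binary form
  \<open>F(t, u) = \<Prod>\<^sub>i (t + x\<^sub>i u) = \<Sum>\<^sub>i C(n, i) E\<^sub>i t\<^bsup>n-i\<^esup> u\<^bsup>i\<^esup>\<close>, all of whose zeros on the projective
  line are real. Up to the factor \<open>n\<close>, the derivative of such a form in a direction \<open>(a, b)\<close>
  is a form of degree \<open>n - 1\<close> that is encoded in the same way by the numbers \<open>a E\<^sub>i + b E\<^bsub>i+1\<^esub>\<close>
  (\<open>polar_binomial_form\<close>). As \<open>f(t) = \<Prod>\<^sub>j (t + \<beta>\<^sub>j)\<close>, differentiating in the \<open>s\<close> directions
  \<open>(\<beta>\<^sub>j, 1)\<close> turns the \<open>E\<^sub>i\<close> into the \<open>S\<^bsub>i+s;s\<^esub>\<close>. Then \<open>k - 1 - s\<close> derivatives in the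
  direction \<open>(0, 1)\<close> and \<open>n - 1 - k\<close> in the direction \<open>(1, 0)\<close> leave the quadratic form
  \<open>S\<^bsub>k-1;s\<^esub> t\<^sup>2 + 2 S\<^bsub>k;s\<^esub> t u + S\<^bsub>k+1;s\<^esub> u\<^sup>2\<close>, up to a nonzero constant factor.

  A derivative in a real direction keeps all zeros real (\<open>polar_real_roots\<close>). So the
  quadratic form has discriminant \<open>\<ge> 0\<close>, which is the inequality.

  If there is equality and the two sides are not zero, then the quadratic form has a double
  finite zero \<open>r \<noteq> 0\<close>. A zero of multiplicity \<open>m \<ge> 2\<close> of a derivative that is not
  identically zero is a zero of the form itself, of multiplicity at least \<open>m + 1\<close>, or at least
  \<open>m\<close> if it is the direction of the derivative (\<open>polar_root_multiplicity\<close>). The directions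
  \<open>(0, 1)\<close> and \<open>(1, 0)\<close> are the points \<open>0\<close> and \<open>\<infinity>\<close>, so going back through all \<open>n - 2\<close> derivatives shows that the multiplicity of \<open>r\<close> in
  \<open>\<Prod>\<^sub>i (t + x\<^sub>i)\<close> is at least \<open>n\<close> minus the number of \<open>j\<close> with \<open>\<beta>\<^sub>j = r\<close>. Thus at least \<open>n\<close> of the
  \<open>x\<^sub>i\<close> and \<open>-\<beta>\<^sub>j\<close> equal \<open>-r\<close>.

  Both facts about one derivative come from the same convexity argument. For a zero \<open>z\<close> of
  the derivative that is not a zero of the form, let \<open>W\<close> consist of the numbers \<open>1/(z - r)\<close>
  with \<open>r\<close> a zero of the form and \<open>w = 1/(z - a/b)\<close>, where \<open>1/(z - \<infinity>) = 0\<close>. Then \<open>w\<close> is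
  the average of \<open>W\<close>. If \<open>z\<close> is not real, then all these numbers lie on one circle through \<open>0\<close>; if \<open>z\<close> is real and a
  double zero, then they are real and the average of their squares is \<open>w\<^sup>2\<close>. In both cases the
  variance vanishes, so every \<open>r\<close> is \<open>a/b\<close> and the derivative is zero.
\<close>

section \<open>Multisets of numbers without variance\<close>

text \<open>
  The sum of the \<open>|z - w|\<^sup>2\<close>, taken over \<open>W\<close> filled up with zeros to \<open>d\<close> elements, vanishes.
  The zeros stand for the missing roots of a polynomial whose degree is below \<open>d\<close>: they
  are its roots at infinity.
\<close>
lemma equal_average:
  fixes W :: "complex multiset" and w :: complex and d :: nat
  assumes sum: "(\<Sum>z\<in>#W. z) = of_nat d * w"
    and sq: "(\<Sum>z\<in>#W. (cmod z)\<^sup>2) = real d * (cmod w)\<^sup>2"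
    and size: "size W \<le> d"
  shows "\<forall>z\<in>#W. z = w" and "size W = d \<or> w = 0"
proof -
  have variance: "(\<Sum>z\<in>#V. (cmod (z - w))\<^sup>2) =
      (\<Sum>z\<in>#V. (cmod z)\<^sup>2) - 2 * Re (cnj w * (\<Sum>z\<in>#V. z)) + real (size V) * (cmod w)\<^sup>2" for V
    by (induction V) (simp_all add: cmod_power2, simp_all add: power2_eq_square algebra_simps)
  have "Re (cnj w * (of_nat d * w)) = real d * (cmod w)\<^sup>2"
    by (simp add: cmod_power2, simp add: power2_eq_square algebra_simps)
  then have dev: "(\<Sum>z\<in>#W. (cmod (z - w))\<^sup>2) = - ((real d - real (size W)) * (cmod w)\<^sup>2)"
    using variance[of W] unfolding sum sq by (simp add: algebra_simps)
  have nonneg: "(\<Sum>z\<in>#W. (cmod (z - w))\<^sup>2) \<ge> 0"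
    by (induction W) auto
  have "(real d - real (size W)) * (cmod w)\<^sup>2 \<ge> 0"
    using size by simp
  then have zero: "(\<Sum>z\<in>#W. (cmod (z - w))\<^sup>2) = 0"
      and "(real d - real (size W)) * (cmod w)\<^sup>2 = 0"
    using dev nonneg by linarith+
  then show "size W = d \<or> w = 0"
    by auto
  have "\<forall>z\<in>#V. z = w" if "(\<Sum>z\<in>#V. (cmod (z - w))\<^sup>2) \<le> 0" for V
    using that
  proof (induction V)
    case (add u V)
    have "(\<Sum>z\<in>#V. (cmod (z - w))\<^sup>2) \<ge> 0"
      by (induction V) auto
    then have "(cmod (u - w))\<^sup>2 \<le> 0" "(\<Sum>z\<in>#V. (cmod (z - w))\<^sup>2) \<le> 0"
      using add.prems zero_le_power2[of "cmod (u - w)"]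
      unfolding image_mset_add_mset sum_mset.add_mset by linarith+
    then show ?case using add.IH by auto
  qed simp
  from this[of W] zero show "\<forall>z\<in>#W. z = w" by linarith
qed

section \<open>Polar derivatives of real-rooted polynomials\<close>

text \<open>
  The sum of the \<open>1/(z - r)\<close> is \<open>p'/p\<close>, and the sum of their squares is \<open>-(p'/p)'\<close>.
\<close>
lemma log_derivative:
  fixes p :: "complex poly"
  assumes "poly p z \<noteq> 0"
  shows "poly (pderiv p) z = poly p z * (\<Sum>r\<in>#proots p. inverse (z - r))"
    and "poly (pderiv (pderiv p)) z = poly p z *
      ((\<Sum>r\<in>#proots p. inverse (z - r))\<^sup>2 - (\<Sum>r\<in>#proots p. (inverse (z - r))\<^sup>2))"
proof -
  define c where "c = lead_coeff p"
  define q where "q R = (\<Prod>r\<in>#R. [:- r, 1:])" for R :: "complex multiset"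
  define R where "R = proots p"
  have p: "p = smult c (q R)"
    unfolding c_def q_def R_def by (rule complex_poly_decompose_multiset[symmetric])
  have ind: "poly (pderiv (q R)) z = poly (q R) z * (\<Sum>r\<in>#R. inverse (z - r)) \<and>
      poly (pderiv (pderiv (q R))) z = poly (q R) z *
        ((\<Sum>r\<in>#R. inverse (z - r))\<^sup>2 - (\<Sum>r\<in>#R. (inverse (z - r))\<^sup>2))"
    if "z \<notin># R" for R
    using that
  proof (induction R)
    case (add r R)
    have q: "q (add_mset r R) = [:- r, 1:] * q R"
      by (simp add: q_def)
    have nz: "z - r \<noteq> 0" using add.prems by auto
    have d: "pderiv [:- r, 1:] = 1" by (simp add: pderiv_pCons)
    have 1: "poly (pderiv (q (add_mset r R))) z = poly (q R) z + (z - r) * poly (pderiv (q R)) z"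
      unfolding q pderiv_mult d by (simp add: algebra_simps)
    have 2: "poly (pderiv (pderiv (q (add_mset r R)))) z =
        2 * poly (pderiv (q R)) z + (z - r) * poly (pderiv (pderiv (q R))) z"
      unfolding q pderiv_mult pderiv_add d by (simp add: pderiv_mult d pderiv_add, simp add: algebra_simps)
    have 3: "poly (q (add_mset r R)) z = (z - r) * poly (q R) z"
      by (simp add: q algebra_simps)
    define u where "u = inverse (z - r)"
    have u: "(z - r) * u = 1" using nz by (simp add: u_def)
    have IH: "poly (pderiv (q R)) z = poly (q R) z * (\<Sum>r\<in>#R. inverse (z - r))"
      "poly (pderiv (pderiv (q R))) z = poly (q R) z *
        ((\<Sum>r\<in>#R. inverse (z - r))\<^sup>2 - (\<Sum>r\<in>#R. (inverse (z - r))\<^sup>2))"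
      using add by auto
    define A where "A = (\<Sum>r\<in>#R. inverse (z - r))"
    define B where "B = (\<Sum>r\<in>#R. (inverse (z - r))\<^sup>2)"
    define Q where "Q = poly (q R) z"
    have "Q + (z - r) * (Q * A) = (z - r) * Q * (u + A)"
      using u by algebra
    moreover have "2 * (Q * A) + (z - r) * (Q * (A\<^sup>2 - B)) = (z - r) * Q * ((u + A)\<^sup>2 - (u\<^sup>2 + B))"
      using u by algebra
    ultimately show ?case
      unfolding 1 2 3 IH image_mset_add_mset sum_mset.add_mset
        A_def[symmetric] B_def[symmetric] Q_def[symmetric] u_def[symmetric] by blast
  qed (simp add: q_def)
  have "p \<noteq> 0" using assms by auto
  then have "z \<notin># proots p" using assms by simp
  note ind = ind[OF this[folded R_def]]
  show "poly (pderiv p) z = poly p z * (\<Sum>r\<in>#proots p. inverse (z - r))"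
    unfolding R_def[symmetric] using ind by (simp add: p pderiv_smult)
  show "poly (pderiv (pderiv p)) z = poly p z *
      ((\<Sum>r\<in>#proots p. inverse (z - r))\<^sup>2 - (\<Sum>r\<in>#proots p. (inverse (z - r))\<^sup>2))"
    unfolding R_def[symmetric] using ind by (simp add: p pderiv_smult)
qed

text \<open>
  A polynomial \<open>p\<close> of degree at most \<open>d\<close> stands for the form \<open>F(t, u) = u\<^bsup>d\<^esup> p(t/u)\<close>. By
  Euler's identity \<open>t F\<^sub>t + u F\<^sub>u = d F\<close>, the polynomial below is \<open>a F\<^sub>t + b F\<^sub>u\<close> at \<open>u = 1\<close>.
\<close>
definition polar :: "nat \<Rightarrow> real \<Rightarrow> real \<Rightarrow> complex poly \<Rightarrow> complex poly" where
  "polar d a b p = smult (of_nat d * of_real b) p + [:of_real a, - of_real b:] * pderiv p"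

lemma poly_polar:
  "poly (polar d a b p) z = of_nat d * of_real b * poly p z + (of_real a - of_real b * z) * poly (pderiv p) z"
  by (simp add: polar_def algebra_simps)

text \<open>
  The equality case of the convexity argument: all roots of \<open>p\<close> are \<open>a/b\<close> (possibly
  infinity), so \<open>p\<close> is a multiple of the \<open>d\<close>-th power of the linear form that vanishes at
  \<open>(a, b)\<close>, and its derivative in that direction is zero.
\<close>
lemma polar_eq_0I:
  fixes p :: "complex poly"
  assumes deg: "degree p \<le> d" and v: "a \<noteq> 0 \<or> b \<noteq> 0"
    and p: "poly p z \<noteq> 0" and z: "of_real b * z \<noteq> of_real a"
    and w: "w = of_real b / (of_real b * z - of_real a)"
    and sum: "(\<Sum>r\<in>#proots p. inverse (z - r)) = of_nat d * w"
    and sq: "(\<Sum>r\<in>#proots p. (cmod (inverse (z - r)))\<^sup>2) = real d * (cmod w)\<^sup>2"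
  shows "polar d a b p = 0"
proof -
  define W where "W = image_mset (\<lambda>r. inverse (z - r)) (proots p)"
  have size: "size W = degree p"
    by (simp add: W_def size_proots_complex)
  have avg: "\<forall>u\<in>#W. u = w" "size W = d \<or> w = 0"
    using equal_average[of W d w] sum sq size deg
    by (simp_all add: W_def image_mset.compositionality o_def)
  have roots: "of_real b * r = of_real a" if r: "r \<in># proots p" for r
  proof -
    have "p \<noteq> 0" using p by auto
    then have "z \<noteq> r" using p r by auto
    moreover have "inverse (z - r) = of_real b / (of_real b * z - of_real a)"
      using avg(1) r w by (auto simp: W_def)
    moreover have "of_real b * z - of_real a \<noteq> 0" using z by simp
    ultimately have "of_real b * z - of_real a = of_real b * (z - r)"
      by (simp add: divide_simps)
    then show ?thesis by (simp add: right_diff_distrib)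
  qed
  define c where "c = lead_coeff p"
  have decomp: "p = smult c (\<Prod>r\<in>#proots p. [:- r, 1:])"
    unfolding c_def by (rule complex_poly_decompose_multiset[symmetric])
  show ?thesis
  proof (cases "b = 0")
    case True
    then have "proots p = {#}" using roots v by (metis multiset_nonemptyE mult_zero_left of_real_0 of_real_eq_0_iff)
    then have "degree p = 0" using size_proots_complex[of p] by simp
    then have "pderiv p = 0" by (simp add: pderiv_eq_0_iff)
    with True show ?thesis by (simp add: polar_def)
  next
    case False
    define \<rho> :: complex where "\<rho> = of_real a / of_real b"
    have "w \<noteq> 0" using False z by (simp add: w)
    then have "size (proots p) = d" using avg(2) by (simp add: W_def)
    moreover have "set_mset (proots p) \<subseteq> {\<rho>}"
      using roots False by (auto simp: \<rho>_def field_simps)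
    ultimately have "proots p = replicate_mset d \<rho>"
      using set_mset_subset_singletonD by metis
    then have "p = smult c ([:- \<rho>, 1:] ^ d)"
      using decomp by simp
    moreover have "[:of_real a, - of_real b:] = smult (- of_real b) [:- \<rho>, 1:]"
      using False by (simp add: \<rho>_def)
    ultimately show ?thesis
      by (cases d) (simp_all add: polar_def pderiv_smult pderiv_power_Suc pderiv_pCons
          mult_smult_left mult_smult_right del: mult_pCons_left mult_pCons_right smult_pCons power_Suc, simp add: algebra_simps)
  qed
qed

lemma real_linear_nonzero:
  assumes "a \<noteq> 0 \<or> b \<noteq> (0::real)" "(z :: complex) \<notin> \<real>"
  shows "of_real b * z \<noteq> of_real a"
proof
  assume h: "of_real b * z = of_real a"
  then have "b \<noteq> 0" using assms(1) by auto
  then have "z = of_real (a / b)" using h by (simp add: field_simps)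
  with assms(2) show False by auto
qed

text \<open>
  For \<open>z\<close> not real, the map \<open>r \<mapsto> 1/(z - r)\<close> sends the real projective line to the circle of
  all \<open>u\<close> with \<open>Im u = - Im z |u|\<^sup>2\<close>. On this circle \<open>|u|\<^sup>2\<close> is linear in \<open>u\<close>, so an equation
  between averages implies the one between averages of squares.
\<close>
lemma polar_real_roots:
  fixes p :: "complex poly"
  assumes deg: "degree p \<le> d" and v: "a \<noteq> 0 \<or> b \<noteq> 0"
    and real: "\<And>z. poly p z = 0 \<Longrightarrow> z \<in> \<real>"
    and nz: "polar d a b p \<noteq> 0" and root: "poly (polar d a b p) z = 0"
  shows "z \<in> \<real>"
proof (rule ccontr)
  assume z: "z \<notin> \<real>"
  then have pz: "poly p z \<noteq> 0" using real by blast
  have bz: "of_real b * z \<noteq> of_real a" using real_linear_nonzero v z by blast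
  have Imz: "Im z \<noteq> 0" using z complex_is_Real_iff by blast
  define w where "w = of_real b / (of_real b * z - of_real a)"
  define y where "y = of_real a - of_real b * z"
  have y: "y \<noteq> 0" using bz by (simp add: y_def)
  have b: "of_real b = - (w * y)" using bz by (simp add: w_def y_def field_simps)
  have "of_nat d * of_real b * poly p z + y * poly (pderiv p) z = 0"
    using root unfolding poly_polar y_def .
  then have "poly p z * (y * ((\<Sum>r\<in>#proots p. inverse (z - r)) - of_nat d * w)) = 0"
    unfolding log_derivative(1)[OF pz] b by algebra
  then have sum: "(\<Sum>r\<in>#proots p. inverse (z - r)) = of_nat d * w"
    using pz y by simp
  \<comment> \<open>With \<open>(s, t) = (a, b)\<close> this concerns \<open>w\<close>, with \<open>t = 1\<close> a root \<open>s\<close> of \<open>p\<close>.\<close>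
  have im: "Im u = - Im z * (cmod u)\<^sup>2"
    if "u = of_real t / (of_real t * z - of_real s)" for u s t
  proof (cases "of_real t * z - of_real s = 0")
    case False
    have "Im u = - (t\<^sup>2 * Im z / (cmod (of_real t * z - of_real s))\<^sup>2)"
      unfolding that Im_divide cmod_power2 by (simp add: power2_eq_square)
    then show ?thesis by (simp add: that norm_divide power_divide)
  qed (simp add: that)
  have "Im (\<Sum>r\<in>#R. inverse (z - r)) = - Im z * (\<Sum>r\<in>#R. (cmod (inverse (z - r)))\<^sup>2)"
    if "set_mset R \<subseteq> \<real>" for R
    using that
  proof (induction R)
    case (add r R)
    obtain s where "r = of_real s" using add.prems by (auto elim: Reals_cases)
    then have "Im (inverse (z - r)) = - Im z * (cmod (inverse (z - r)))\<^sup>2"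
      using im[of "inverse (z - r)" 1 s] by (simp add: inverse_eq_divide)
    with add show ?case by (simp add: algebra_simps)
  qed simp
  moreover have "set_mset (proots p) \<subseteq> \<real>"
  proof -
    have "p \<noteq> 0" using pz by auto
    then show ?thesis using real by auto
  qed
  ultimately have "Im (of_nat d * w) = - Im z * (\<Sum>r\<in>#proots p. (cmod (inverse (z - r)))\<^sup>2)"
    using sum by metis
  moreover have "Im (of_nat d * w) = - Im z * (real d * (cmod w)\<^sup>2)"
    using im[OF w_def] by simp
  ultimately have sq: "(\<Sum>r\<in>#proots p. (cmod (inverse (z - r)))\<^sup>2) = real d * (cmod w)\<^sup>2"
    using Imz by simp
  from polar_eq_0I[OF deg v pz bz w_def sum sq] nz show False by simp
qed

text \<open>
  At a simple root of the derivative this may fail, by Rolle's theorem. At a multiple one the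
  second equation determines \<open>p''/p\<close> and thus the sum of the squares \<open>1/(c - r)\<^sup>2\<close>; equality
  in the Cauchy-Schwarz inequality then makes all roots equal.
\<close>
lemma polar_multiple_root:
  fixes p :: "complex poly"
  assumes deg: "degree p \<le> d" and v: "a \<noteq> 0 \<or> b \<noteq> 0"
    and real: "\<And>z. poly p z = 0 \<Longrightarrow> z \<in> \<real>"
    and nz: "polar d a b p \<noteq> 0" and m: "m \<ge> 2"
    and c: "c \<in> \<real>" and dvd: "[:- c, 1:] ^ m dvd polar d a b p"
  shows "poly p c = 0"
proof (rule ccontr)
  assume pc: "poly p c \<noteq> 0"
  have "[:- c, 1:] ^ 2 dvd polar d a b p"
    using dvd m le_imp_power_dvd dvd_trans by blast
  then obtain q where q: "polar d a b p = [:- c, 1:] ^ 2 * q" by blast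
  have r0: "poly (polar d a b p) c = 0" by (simp add: q)
  have r1: "poly (pderiv (polar d a b p)) c = 0"
    unfolding q pderiv_mult by (simp add: pderiv_mult power2_eq_square pderiv_pCons)
  have bc: "of_real b * c \<noteq> of_real a"
  proof
    assume *: "of_real b * c = of_real a"
    then have "of_nat d * of_real b * poly p c = 0"
      using r0 by (simp add: poly_polar)
    with pc v * have "d = 0" by auto
    with deg have "pderiv p = 0" by (simp add: pderiv_eq_0_iff)
    with \<open>d = 0\<close> nz show False by (simp add: polar_def)
  qed
  define w where "w = of_real b / (of_real b * c - of_real a)"
  define A where "A = (\<Sum>r\<in>#proots p. inverse (c - r))"
  define B where "B = (\<Sum>r\<in>#proots p. (inverse (c - r))\<^sup>2)"
  define y where "y = of_real a - of_real b * c"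
  have y: "y \<noteq> 0" using bc by (simp add: y_def)
  have b: "of_real b = - (w * y)" using bc by (simp add: w_def y_def field_simps)
  have "of_nat d * of_real b * poly p c + y * poly (pderiv p) c = 0"
    using r0 unfolding poly_polar y_def .
  then have "poly p c * (y * (A - of_nat d * w)) = 0"
    unfolding log_derivative(1)[OF pc] A_def[symmetric] b by algebra
  then have sum: "A = of_nat d * w"
    using pc y by simp
  have "(of_nat d - 1) * of_real b * poly (pderiv p) c + y * poly (pderiv (pderiv p)) c = 0"
    using r1 by (simp add: polar_def pderiv_add pderiv_smult pderiv_mult pderiv_pCons pderiv_minus y_def algebra_simps)
  then have "poly p c * (y * (of_nat d * w\<^sup>2 - B)) = 0"
    unfolding log_derivative[OF pc] A_def[symmetric] B_def[symmetric] b sum by algebra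
  then have B: "B = of_nat d * w\<^sup>2"
    using pc y by simp
  have sqr: "of_real ((cmod u)\<^sup>2) = u\<^sup>2" if "u \<in> \<real>" for u :: complex
    using that by (auto elim!: Reals_cases simp flip: of_real_power)
  have "of_real (\<Sum>r\<in>#R. (cmod (inverse (c - r)))\<^sup>2) = (\<Sum>r\<in>#R. (inverse (c - r))\<^sup>2)"
    if "set_mset R \<subseteq> \<real>" for R
    using that
  proof (induction R)
    case (add r R)
    then have "inverse (c - r) \<in> \<real>" using c by auto
    from sqr[OF this] add show ?case by simp
  qed simp
  moreover have "set_mset (proots p) \<subseteq> \<real>"
  proof -
    have "p \<noteq> 0" using pc by auto
    then show ?thesis using real by auto
  qed
  ultimately have "of_real (\<Sum>r\<in>#proots p. (cmod (inverse (c - r)))\<^sup>2) = B"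
    by (simp add: B_def)
  also have "B = of_real (real d * (cmod w)\<^sup>2)"
    using sqr[of w] c unfolding B by (simp add: w_def)
  finally have sq: "(\<Sum>r\<in>#proots p. (cmod (inverse (c - r)))\<^sup>2) = real d * (cmod w)\<^sup>2"
    using of_real_eq_iff by blast
  from polar_eq_0I[OF deg v pc bc w_def sum[unfolded A_def] sq] nz show False by simp
qed

text \<open>
  Once \<open>c\<close> is known to be a root of \<open>p\<close>, of order \<open>e \<ge> 1\<close> say, the order of \<open>c\<close> in the
  derivative is \<open>e - 1\<close>, unless \<open>c\<close> is the direction \<open>a/b\<close>, where it is \<open>e\<close>.
\<close>
lemma polar_root_multiplicity:
  fixes p :: "complex poly"
  assumes deg: "degree p \<le> d" and v: "a \<noteq> 0 \<or> b \<noteq> 0"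
    and real: "\<And>z. poly p z = 0 \<Longrightarrow> z \<in> \<real>"
    and nz: "polar d a b p \<noteq> 0" and m: "m \<ge> 2"
    and c: "c \<in> \<real>" and dvd: "[:- c, 1:] ^ m dvd polar d a b p"
  shows "[:- c, 1:] ^ (if of_real b * c = of_real a then m else Suc m) dvd p"
proof -
  have p0: "p \<noteq> 0" using nz by (auto simp: polar_def)
  define e where "e = order c p"
  have "poly p c = 0" using polar_multiple_root[OF assms] by simp
  then obtain e' where e': "e = Suc e'" using p0 by (metis e_def order_root not0_implies_Suc)
  obtain q where p: "p = [:- c, 1:] ^ e * q" and "\<not> [:- c, 1:] dvd q"
    using order_decomp[OF p0] unfolding e_def by blast
  then have q: "poly q c \<noteq> 0" by (simp add: poly_eq_0_iff_dvd)
  have lin: "pderiv [:- c, 1:] = 1" by (simp add: pderiv_pCons)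
  have pd: "pderiv p = [:- c, 1:] ^ e' * (smult (of_nat e) q + [:- c, 1:] * pderiv q)"
    unfolding p e' pderiv_mult pderiv_power_Suc lin
    by (simp add: algebra_simps del: mult_pCons_left mult_pCons_right)
  define g where "g = smult (of_nat d * of_real b) ([:- c, 1:] * q)
    + [:of_real a, - of_real b:] * (smult (of_nat e) q + [:- c, 1:] * pderiv q)"
  have D: "polar d a b p = [:- c, 1:] ^ e' * g"
    unfolding polar_def pd g_def unfolding p e'
    by (simp add: algebra_simps del: mult_pCons_left mult_pCons_right)
  show ?thesis
  proof (cases "of_real b * c = of_real a")
    case False
    have "poly g c = of_nat e * ((of_real a - of_real b * c) * poly q c)"
      by (simp add: g_def algebra_simps)
    moreover have "(of_nat e :: complex) \<noteq> 0" unfolding e' by (rule of_nat_neq_0)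
    ultimately have "poly g c \<noteq> 0" using False q by auto
    then have "order c (polar d a b p) = e'"
      using nz unfolding D by (subst order_mult) (auto simp: order_power_n_n order_0I)
    then have "m \<le> e'" using dvd nz by (simp add: order_divides)
    then have "[:- c, 1:] ^ Suc m dvd [:- c, 1:] ^ e"
      unfolding e' by (intro le_imp_power_dvd) simp
    then show ?thesis unfolding p using False by (simp only: if_False dvd_mult2)
  next
    case True
    define h where "h = smult (of_nat d * of_real b) q
      - smult (of_real b) (smult (of_nat e) q + [:- c, 1:] * pderiv q)"
    have lin: "[:of_real a, - of_real b:] = smult (- of_real b) [:- c, 1:]"
      using True by simp
    have D: "polar d a b p = [:- c, 1:] ^ e * h"
      unfolding D g_def h_def lin e'
      by (simp add: algebra_simps smult_add_right del: mult_pCons_left mult_pCons_right smult_pCons)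
    have q0: "q \<noteq> 0" using q by auto
    have deg': "e + degree q \<le> d"
      using deg q0 unfolding p by (simp add: degree_mult_eq degree_power_eq)
    \<comment> \<open>If \<open>d = e\<close>, then \<open>p\<close> is a multiple of \<open>(t - c)\<^bsup>d\<^esup>\<close>, whose derivative in the direction \<open>c\<close> is zero.\<close>
    have "d \<noteq> e"
    proof
      assume "d = e"
      then have "pderiv q = 0" using deg' by (simp add: pderiv_eq_0_iff)
      with \<open>d = e\<close> have "h = 0" by (simp add: h_def mult.commute)
      with D nz show False by simp
    qed
    moreover have "poly h c = of_real b * (of_nat d - of_nat e) * poly q c"
      by (simp add: h_def algebra_simps)
    ultimately have "poly h c \<noteq> 0" using True v q by auto
    then have "order c (polar d a b p) = e"
      using nz unfolding D by (subst order_mult) (auto simp: order_power_n_n order_0I)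
    then have "m \<le> e" using dvd nz by (simp add: order_divides)
    with True show ?thesis using p by (simp add: le_imp_power_dvd dvd_mult2)
  qed
qed

section \<open>Forms with binomially weighted coefficients\<close>

text \<open>
  The form \<open>\<Sum>\<^sub>i C(d, i) c\<^sub>i t\<^bsup>d-i\<^esup> u\<^bsup>i\<^esup>\<close> at \<open>u = 1\<close>, summed over the exponent \<open>j = d - i\<close> of \<open>t\<close>.
  The coefficients are complex because the arguments about roots use nonreal points.
\<close>
definition binomial_form :: "nat \<Rightarrow> (nat \<Rightarrow> real) \<Rightarrow> complex poly" where
  "binomial_form d c = (\<Sum>j\<le>d. monom (of_real (real (d choose j) * c (d - j))) j)"

lemma coeff_binomial_form:
  "coeff (binomial_form d c) j = (if j \<le> d then of_real (real (d choose j) * c (d - j)) else 0)"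
  by (simp add: binomial_form_def coeff_sum sum.delta)

lemma degree_binomial_form: "degree (binomial_form d c) \<le> d"
  by (rule degree_le) (simp add: coeff_binomial_form)

text \<open>
  The binomial weights make differentiation independent of the degree, up to a constant:
  \<open>\<partial>\<^sub>t\<close> keeps the sequence \<open>c\<close> and \<open>\<partial>\<^sub>u\<close> shifts it.
\<close>
lemma polar_binomial_form:
  "polar (Suc d) a b (binomial_form (Suc d) c)
    = smult (of_nat (Suc d)) (binomial_form d (\<lambda>i. a * c i + b * c (Suc i)))"
proof (rule poly_eqI)
  fix j
  let ?p = "binomial_form (Suc d) c"
  have lhs: "coeff (polar (Suc d) a b ?p) j
      = of_real b * (of_nat (Suc d) - of_nat j) * coeff ?p j + of_real a * of_nat (Suc j) * coeff ?p (Suc j)"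
    by (cases j) (simp_all add: polar_def coeff_pderiv algebra_simps)
  have "coeff (polar (Suc d) a b ?p) j
      = of_real (real (Suc d) * (if j \<le> d then real (d choose j) * (a * c (d - j) + b * c (Suc (d - j))) else 0))"
  proof (cases "j \<le> d")
    case True
    have 1: "real (Suc j) * real (Suc d choose Suc j) = real (Suc d) * real (d choose j)"
      using Suc_times_binomial[of j d] by (metis of_nat_mult)
    have "(Suc d - j) * (Suc d choose j) = Suc d * (d choose j)"
      using binomial_absorb_comp[of "Suc d" j] by simp
    then have 2: "(real (Suc d) - real j) * real (Suc d choose j) = real (Suc d) * real (d choose j)"
      using True by (metis le_SucI of_nat_diff of_nat_mult)
    have "b * (real (Suc d) - real j) * (real (Suc d choose j) * c (Suc d - j))
        + a * real (Suc j) * (real (Suc d choose Suc j) * c (d - j))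
      = b * c (Suc (d - j)) * ((real (Suc d) - real j) * real (Suc d choose j))
        + a * c (d - j) * (real (Suc j) * real (Suc d choose Suc j))"
      by (simp only: Suc_diff_le[OF True] mult_ac)
    also have "\<dots> = real (Suc d) * (real (d choose j) * (a * c (d - j) + b * c (Suc (d - j))))"
      unfolding 1 2 by (simp only: algebra_simps)
    finally have eq: "b * (real (Suc d) - real j) * (real (Suc d choose j) * c (Suc d - j))
        + a * real (Suc j) * (real (Suc d choose Suc j) * c (d - j))
      = real (Suc d) * (real (d choose j) * (a * c (d - j) + b * c (Suc (d - j))))" .
    from arg_cong[OF eq, of complex_of_real] show ?thesis
      unfolding lhs using True by (simp add: coeff_binomial_form del: binomial_Suc_Suc of_nat_Suc)
  qed (auto simp: lhs coeff_binomial_form le_Suc_eq)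
  then show "coeff (polar (Suc d) a b ?p) j
      = coeff (smult (of_nat (Suc d)) (binomial_form d (\<lambda>i. a * c i + b * c (Suc i)))) j"
    by (simp add: coeff_binomial_form)
qed

text \<open>The zero polynomial is included, since derivatives may vanish identically.\<close>
definition real_rooted :: "complex poly \<Rightarrow> bool" where
  "real_rooted p \<longleftrightarrow> p = 0 \<or> (\<forall>z. poly p z = 0 \<longrightarrow> z \<in> \<real>)"

lemma binomial_form_step:
  assumes v: "a \<noteq> 0 \<or> b \<noteq> 0" and rr: "real_rooted (binomial_form (Suc d) c)"
    and c': "c' = (\<lambda>i. a * c i + b * c (Suc i))"
  shows "real_rooted (binomial_form d c')"
    and "binomial_form d c' \<noteq> 0 \<Longrightarrow> m \<ge> 2 \<Longrightarrow> [:- of_real r, 1:] ^ m dvd binomial_form d c'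
      \<Longrightarrow> [:- of_real r, 1:] ^ (if b * r = a then m else Suc m) dvd binomial_form (Suc d) c"
proof -
  let ?p = "binomial_form (Suc d) c" and ?q = "binomial_form d c'"
  have D: "polar (Suc d) a b ?p = smult (of_nat (Suc d)) ?q"
    unfolding c' by (rule polar_binomial_form)
  have nz: "(of_nat (Suc d) :: complex) \<noteq> 0" by (rule of_nat_neq_0)
  have real: "\<And>z. poly ?p z = 0 \<Longrightarrow> z \<in> \<real>" if "?q \<noteq> 0"
  proof -
    have "?p \<noteq> 0" using that D nz by (auto simp: polar_def simp del: of_nat_Suc)
    then show "\<And>z. poly ?p z = 0 \<Longrightarrow> z \<in> \<real>" using rr by (auto simp: real_rooted_def)
  qed
  have D0: "polar (Suc d) a b ?p \<noteq> 0" if "?q \<noteq> 0"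
    using that nz unfolding D by simp
  show "real_rooted ?q"
    using polar_real_roots[OF degree_binomial_form v real D0] nz
    unfolding real_rooted_def D by auto
  show "[:- of_real r, 1:] ^ (if b * r = a then m else Suc m) dvd ?p"
    if "?q \<noteq> 0" "m \<ge> 2" "[:- of_real r, 1:] ^ m dvd ?q"
  proof -
    have "[:- of_real r, 1:] ^ m dvd polar (Suc d) a b ?p"
      unfolding D by (rule dvd_smult[OF that(3)])
    from polar_root_multiplicity[OF degree_binomial_form v real[OF that(1)] D0[OF that(1)] that(2) _ this]
    show ?thesis by (simp flip: of_real_mult)
  qed
qed

section \<open>Repeated differentiation\<close>

text \<open>
  The polynomial \<open>f\<close> evaluated at the shift operator on sequences. Differentiation in the
  directions \<open>(\<beta>\<^sub>j, 1)\<close> acts on the coefficient sequence as \<open>\<Prod>\<^sub>j (X + \<beta>\<^sub>j)\<close>.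
\<close>
definition shift_act :: "real poly \<Rightarrow> (nat \<Rightarrow> real) \<Rightarrow> nat \<Rightarrow> real" where
  "shift_act f c i = (\<Sum>l\<le>degree f. coeff f l * c (i + l))"

lemma shift_act_altdef:
  assumes "degree f \<le> N"
  shows "shift_act f c i = (\<Sum>l\<le>N. coeff f l * c (i + l))"
  unfolding shift_act_def using assms
  by (intro sum.mono_neutral_left) (auto simp: coeff_eq_0)

lemma shift_act_linear_factor:
  "shift_act ([:b, 1:] * f) c = (\<lambda>i. b * shift_act f c i + shift_act f c (Suc i))"
proof
  fix i
  define N where "N = Suc (degree f)"
  have "degree ([:b, 1:] * f) \<le> N"
    using degree_mult_le[of "[:b, 1:]" f] by (simp add: N_def)
  then have "shift_act ([:b, 1:] * f) c i
      = (\<Sum>l\<le>N. b * (coeff f l * c (i + l)) + (case l of 0 \<Rightarrow> 0 | Suc l' \<Rightarrow> coeff f l') * c (i + l))"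
    by (simp add: shift_act_altdef coeff_pCons algebra_simps split: nat.split)
  also have "\<dots> = b * (\<Sum>l\<le>N. coeff f l * c (i + l))
      + (\<Sum>l\<le>N. (case l of 0 \<Rightarrow> 0 | Suc l' \<Rightarrow> coeff f l') * c (i + l))"
    by (simp add: sum.distrib sum_distrib_left)
  also have "(\<Sum>l\<le>N. (case l of 0 \<Rightarrow> 0 | Suc l' \<Rightarrow> coeff f l') * c (i + l)) = shift_act f c (Suc i)"
    unfolding N_def sum.atMost_Suc_shift by (simp add: shift_act_def)
  also have "(\<Sum>l\<le>N. coeff f l * c (i + l)) = shift_act f c i"
    by (rule shift_act_altdef[symmetric]) (simp add: N_def)
  finally show "shift_act ([:b, 1:] * f) c i = b * shift_act f c i + shift_act f c (Suc i)" .
qed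

text \<open>
  One derivative in the direction \<open>(b, 1)\<close> for every \<open>b\<close> in \<open>R\<close>. Each of them adds one to the
  multiplicity of \<open>r\<close>, except those with \<open>b = r\<close>.
\<close>
lemma binomial_form_shift_act:
  assumes "real_rooted (binomial_form (d + size R) c)"
  shows "real_rooted (binomial_form d (shift_act (\<Prod>b\<in>#R. [:b, 1:]) c))"
    and "binomial_form d (shift_act (\<Prod>b\<in>#R. [:b, 1:]) c) \<noteq> 0 \<Longrightarrow> m \<ge> 2
      \<Longrightarrow> [:- of_real r, 1:] ^ m dvd binomial_form d (shift_act (\<Prod>b\<in>#R. [:b, 1:]) c)
      \<Longrightarrow> [:- of_real r, 1:] ^ (m + size {#b \<in># R. b \<noteq> r#}) dvd binomial_form (d + size R) c"
  using assms
proof (induction R arbitrary: d m)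
  case empty
  { case 1 then show ?case by (simp add: shift_act_def)
  next case 2 then show ?case by (simp add: shift_act_def) }
next
  case (add b R)
  let ?c = "shift_act (\<Prod>b\<in>#R. [:b, 1:]) c"
  let ?c' = "shift_act (\<Prod>b\<in>#add_mset b R. [:b, 1:]) c"
  have c': "?c' = (\<lambda>i. b * ?c i + 1 * ?c (Suc i))"
    using shift_act_linear_factor[of b "\<Prod>b\<in>#R. [:b, 1:]" c] by simp
  { case 1
    then have "real_rooted (binomial_form (Suc d + size R) c)" by simp
    note rr = add.IH(1)[OF this]
    show ?case by (rule binomial_form_step(1)[OF _ rr c']) simp
  next
    case 2
    then have h: "real_rooted (binomial_form (Suc d + size R) c)" by simp
    note rr = add.IH(1)[OF h]
    have dv: "[:- of_real r, 1:] ^ (if 1 * r = b then m else Suc m) dvd binomial_form (Suc d) ?c"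
      by (rule binomial_form_step(2)[OF _ rr c' 2(1,2,3)]) simp
    have nz: "binomial_form (Suc d) ?c \<noteq> 0"
      using 2(1) polar_binomial_form[of d b 1 ?c] c'
      by (auto simp: polar_def simp del: of_nat_Suc)
    have "[:- of_real r, 1:] ^ ((if 1 * r = b then m else Suc m) + size {#b \<in># R. b \<noteq> r#})
        dvd binomial_form (Suc d + size R) c"
      by (rule add.IH(2)[OF nz _ dv h]) (use 2(2) in auto)
    then show ?case by (auto split: if_splits)
  }
qed

text \<open>
  The derivatives in the direction \<open>(1, 0)\<close>, which is the point at infinity and so never the
  root \<open>r\<close>.
\<close>
lemma binomial_form_truncate:
  assumes "real_rooted (binomial_form (d + e) c)"
  shows "real_rooted (binomial_form d c)"
    and "binomial_form d c \<noteq> 0 \<Longrightarrow> m \<ge> 2 \<Longrightarrow> [:- of_real r, 1:] ^ m dvd binomial_form d c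
      \<Longrightarrow> [:- of_real r, 1:] ^ (m + e) dvd binomial_form (d + e) c"
  using assms
proof (induction e arbitrary: d m)
  case (Suc e)
  have c: "c = (\<lambda>i. 1 * c i + 0 * c (Suc i))" by simp
  { case 1
    then have "real_rooted (binomial_form (Suc d + e) c)" by simp
    note rr = Suc.IH(1)[OF this]
    show ?case by (rule binomial_form_step(1)[OF _ rr c]) simp
  next
    case 2
    then have h: "real_rooted (binomial_form (Suc d + e) c)" by simp
    note rr = Suc.IH(1)[OF h]
    have dv: "[:- of_real r, 1:] ^ (if 0 * r = 1 then m else Suc m) dvd binomial_form (Suc d) c"
      by (rule binomial_form_step(2)[OF _ rr c 2(1,2,3)]) simp
    have nz: "binomial_form (Suc d) c \<noteq> 0"
      using 2(1) polar_binomial_form[of d 1 0 c]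
      by (auto simp: polar_def simp del: of_nat_Suc)
    have "[:- of_real r, 1:] ^ (Suc m + e) dvd binomial_form (Suc d + e) c"
      by (rule Suc.IH(2)[OF nz _ _ h]) (use 2(2) dv in auto)
    then show ?case by simp
  }
qed simp_all

section \<open>The quadratic form and the form of the elementary symmetric means\<close>

lemma quadratic_form_discriminant:
  assumes "real_rooted (binomial_form 2 c)"
  shows "c 0 * c 2 \<le> (c 1)\<^sup>2"
    and "c 0 * c 2 = (c 1)\<^sup>2 \<Longrightarrow> c 0 \<noteq> 0
      \<Longrightarrow> [:- of_real (- c 1 / c 0), 1:] ^ 2 dvd binomial_form 2 c"
proof -
  have form: "binomial_form 2 c = [:of_real (c 2), 2 * of_real (c 1), of_real (c 0):]"
    by (simp add: binomial_form_def numeral_2_eq_2 monom_Suc monom_0)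
  show "c 0 * c 2 \<le> (c 1)\<^sup>2"
  proof (rule ccontr)
    assume neg: "\<not> c 0 * c 2 \<le> (c 1)\<^sup>2"
    then have c0: "c 0 \<noteq> 0" by auto
    \<comment> \<open>A nonreal root \<open>z\<close> of \<open>c\<^sub>0 z\<^sup>2 + 2 c\<^sub>1 z + c\<^sub>2\<close>, from the quadratic formula.\<close>
    define w where "w = sqrt (c 0 * c 2 - (c 1)\<^sup>2)"
    have w: "w > 0" "w\<^sup>2 = c 0 * c 2 - (c 1)\<^sup>2" using neg by (auto simp: w_def)
    define z where "z = Complex (- c 1 / c 0) (w / c 0)"
    have "of_real (c 0) * z = Complex (- c 1) w"
      using c0 by (simp add: z_def complex_eq_iff)
    then have "(of_real (c 0) * z + of_real (c 1))\<^sup>2 = - of_real (w\<^sup>2)"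
      by (simp add: complex_eq_iff power2_eq_square)
    then have "of_real (c 0) * poly (binomial_form 2 c) z = 0"
      unfolding w(2) form by (simp add: power2_eq_square algebra_simps)
    then have "poly (binomial_form 2 c) z = 0" using c0 by simp
    moreover have "binomial_form 2 c \<noteq> 0" using c0 by (simp add: form)
    ultimately have "z \<in> \<real>" using assms by (auto simp: real_rooted_def)
    then show False using w(1) c0 by (simp add: z_def complex_is_Real_iff)
  qed
  assume eq: "c 0 * c 2 = (c 1)\<^sup>2" and c0: "c 0 \<noteq> 0"
  define r where "r = - c 1 / c 0"
  have c1: "c 1 = - c 0 * r" using c0 by (simp add: r_def)
  have "c 0 * c 2 = c 0 * (c 0 * r\<^sup>2)" unfolding eq c1 by (simp add: power2_eq_square algebra_simps)
  then have "c 2 = c 0 * r\<^sup>2" using c0 by simp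
  then have "binomial_form 2 c = smult (of_real (c 0)) ([:- of_real r, 1:] ^ 2)"
    unfolding form c1 by (simp add: power2_eq_square algebra_simps)
  then show "[:- of_real (- c 1 / c 0), 1:] ^ 2 dvd binomial_form 2 c"
    unfolding r_def[symmetric] by (simp add: dvd_smult)
qed

lemma binomial_form_elem_mean:
  "binomial_form n (\<lambda>i. elem_mean n x (int i)) = (\<Prod>i\<in>{1..n}. [:of_real (x i), 1:])"
proof -
  have "(\<Prod>i\<in>{1..n}. [:of_real (x i), 1:]) = (\<Prod>i\<in>{1..n}. [:complex_of_real (x i):] + monom 1 1)"
    by (simp add: monom_altdef)
  also have "\<dots> = (\<Sum>X\<in>Pow {1..n}. (\<Prod>i\<in>X. [:complex_of_real (x i):]) * (\<Prod>i\<in>{1..n} - X. monom 1 1))"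
    by (rule prod_add) simp
  also have "\<dots> = (\<Sum>X\<in>Pow {1..n}. monom (of_real (\<Prod>i\<in>X. x i)) (n - card X))"
  proof (rule sum.cong)
    fix X assume "X \<in> Pow {1..n}"
    then have X: "X \<subseteq> {1..n}" "finite X" by (auto intro: finite_subset)
    have "(\<Prod>i\<in>X. [:complex_of_real (x i):]) = [:of_real (\<Prod>i\<in>X. x i):]"
      using X(2) by (induction X) (auto simp: one_pCons)
    moreover have "card ({1..n} - X) = n - card X" using X by (simp add: card_Diff_subset)
    ultimately show "(\<Prod>i\<in>X. [:complex_of_real (x i):]) * (\<Prod>i\<in>{1..n} - X. monom 1 1)
        = monom (of_real (\<Prod>i\<in>X. x i)) (n - card X)"
      by (simp add: monom_power smult_monom)
  qed simp
  finally have prod: "(\<Prod>i\<in>{1..n}. [:of_real (x i), 1:])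
      = (\<Sum>X\<in>Pow {1..n}. monom (complex_of_real (\<Prod>i\<in>X. x i)) (n - card X))" .
  show ?thesis
  proof (rule poly_eqI)
    fix j
    have "coeff (\<Prod>i\<in>{1..n}. [:complex_of_real (x i), 1:]) j
        = (\<Sum>X\<in>Pow {1..n}. if n - card X = j then of_real (\<Prod>i\<in>X. x i) else 0)"
      unfolding prod by (simp add: coeff_sum del: of_real_prod)
    also have "\<dots> = (\<Sum>X | X \<in> Pow {1..n} \<and> n - card X = j. of_real (\<Prod>i\<in>X. x i))"
      by (rule sum.inter_filter[symmetric]) simp
    also have "\<dots> = (if j \<le> n then of_real (elem_sym n x (int (n - j))) else 0)"
    proof (cases "j \<le> n")
      case True
      have "card X \<le> n" if "X \<subseteq> {1..n}" for X
        using card_mono[OF _ that] by simp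
      then have "{X. X \<in> Pow {1..n} \<and> n - card X = j} = {X. X \<subseteq> {1..n} \<and> int (card X) = int (n - j)}"
        using True by fastforce
      then show ?thesis using True by (simp add: elem_sym_def)
    next
      case False
      then have empty: "{X. X \<in> Pow {1..n} \<and> n - card X = j} = {}" by auto
      show ?thesis unfolding empty using False by simp
    qed
    also have "\<dots> = coeff (binomial_form n (\<lambda>i. elem_mean n x (int i))) j"
      by (auto simp: coeff_binomial_form elem_mean_def binomial_symmetric[symmetric])
    finally show "coeff (binomial_form n (\<lambda>i. elem_mean n x (int i))) j
        = coeff (\<Prod>i\<in>{1..n}. [:complex_of_real (x i), 1:]) j" by simp
  qed
qed

lemma linear_power_dvd_prod_imp_card:
  assumes "[:- of_real r, 1:] ^ m dvd (\<Prod>i\<in>I. [:complex_of_real (x i), 1:])" and "finite I"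
  shows "m \<le> card {i \<in> I. x i = - r}"
proof -
  let ?P = "\<Prod>i\<in>I. [:complex_of_real (x i), 1:]"
  have nz: "?P \<noteq> 0" using assms(2) by simp
  then have "m \<le> count (proots ?P) (of_real r)"
    using assms(1) by (simp add: order_divides)
  also have "proots ?P = (\<Sum>i\<in>I. {#- complex_of_real (x i)#})"
    by (subst proots_prod) auto
  also have "count \<dots> (of_real r) = (\<Sum>i\<in>I. if x i = - r then 1 else 0)"
    by (auto simp: count_sum complex_eq_iff intro!: sum.cong)
  also have "\<dots> = card {i \<in> I. x i = - r}"
    using assms(2) by (simp add: sum.If_cases Int_def)
  finally show ?thesis .
qed

section \<open>The sequence of the sums S and the theorem\<close>

lemma coeff_assoc_poly:
  "coeff (assoc_poly s \<alpha>) l = (if l = s then 1 else if l < s then \<alpha> (s - l) else 0)"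
proof -
  have "(\<Sum>i=1..s. if s - i = l then \<alpha> i else 0) = (\<Sum>i=1..s. if i = s - l \<and> l < s then \<alpha> i else 0)"
    by (rule sum.cong) auto
  also have "\<dots> = (if l < s then \<alpha> (s - l) else 0)"
    by (auto simp: sum.delta)
  finally show ?thesis by (simp add: assoc_poly_def coeff_sum)
qed

lemma degree_assoc_poly: "degree (assoc_poly s \<alpha>) = s"
  by (rule antisym[OF degree_le le_degree]) (auto simp: coeff_assoc_poly)

text \<open>
  If the two monic polynomials of equal degree were different, their difference would have
  smaller degree but still all the roots of \<open>p\<close>.
\<close>
lemma monic_eq_prod_proots:
  fixes p :: "'a::idom poly"
  assumes "lead_coeff p = 1" and "size (proots p) = degree p"
  shows "p = (\<Prod>r\<in>#proots p. [:- r, 1:])"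
proof (rule ccontr)
  define q where "q = (\<Prod>r\<in>#proots p. [:- r, 1:])"
  assume "p \<noteq> (\<Prod>r\<in>#proots p. [:- r, 1:])"
  then have nz: "p - q \<noteq> 0" by (simp add: q_def)
  have p0: "p \<noteq> 0" using assms(1) by auto
  have q: "lead_coeff (\<Prod>r\<in>#R. [:- r, 1:]) = 1 \<and> degree (\<Prod>r\<in>#R. [:- r, 1:]) = size R
      \<and> proots (\<Prod>r\<in>#R. [:- r, 1:]) = R \<and> (\<Prod>r\<in>#R. [:- r, 1:]) \<noteq> 0" for R :: "'a multiset"
  proof (induction R)
    case (add a R)
    then show ?case
      using lead_coeff_mult[of "[:- a, 1:]" "\<Prod>r\<in>#R. [:- r, 1:]"]
      by (auto simp: degree_mult_eq proots_mult simp del: mult_pCons_left)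
  qed simp
  have "proots p \<subseteq># proots (p - q)"
  proof (rule mset_subset_eqI)
    fix a
    let ?l = "[:- a, 1:] ^ order a p"
    have "?l dvd p" by (rule order_1)
    moreover have "?l dvd q"
    proof -
      have "q \<noteq> 0" and "proots q = proots p"
        using q[of "proots p"] unfolding q_def by blast+
      then have "order a q = order a p" using p0 by (metis count_proots)
      then show ?thesis by (metis order_1)
    qed
    ultimately have "?l dvd p - q" by (rule dvd_diff)
    then show "count (proots p) a \<le> count (proots (p - q)) a"
      using nz p0 by (simp add: order_divides)
  qed
  then have "degree p \<le> degree (p - q)"
    using size_mset_mono size_proots_le assms(2) by (metis order_trans)
  moreover have "degree q = degree p" "lead_coeff q = 1"
    using q[of "proots p"] assms(2) unfolding q_def by argo+
  ultimately have "degree (p - q) = degree p" and "coeff (p - q) (degree p) = 0"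
    using assms(1) degree_diff_le[of p "degree p" q] by (simp_all add: antisym)
  then have "lead_coeff (p - q) = 0" by simp
  with nz show False by (simp only: leading_coeff_0_iff)
qed

lemma shift_act_assoc_poly:
  "shift_act (assoc_poly s \<alpha>) (\<lambda>i. elem_mean n x (int i)) i = S_mean n s \<alpha> x (int (i + s))"
proof -
  let ?E = "\<lambda>i. elem_mean n x (int i)"
  have "shift_act (assoc_poly s \<alpha>) ?E i = (\<Sum>l<s. \<alpha> (s - l) * ?E (i + l)) + ?E (i + s)"
    unfolding shift_act_def degree_assoc_poly lessThan_Suc_atMost[symmetric]
    by (simp add: coeff_assoc_poly)
  also have "(\<Sum>l<s. \<alpha> (s - l) * ?E (i + l)) = (\<Sum>j=1..s. \<alpha> j * elem_mean n x (int (i + s) - int j))"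
    by (rule sum.reindex_bij_witness[of _ "\<lambda>j. s - j" "\<lambda>l. s - l"]) (auto simp: algebra_simps)
  finally show ?thesis by (simp add: S_mean_def)
qed

lemma shift_act_power:
  "shift_act ([:0, 1:] ^ t * f) c i = shift_act f c (i + t)"
proof (induction t arbitrary: i)
  case (Suc t)
  have "shift_act ([:0, 1:] ^ Suc t * f) c i = shift_act ([:0, 1:] * ([:0, 1:] ^ t * f)) c i"
    by (simp only: power_Suc mult.assoc)
  then show ?case by (simp only: shift_act_linear_factor Suc.IH) simp
qed simp

theorem theorem1:
  fixes n s :: nat and x \<alpha> \<beta> :: "nat \<Rightarrow> real" and k :: int
  assumes "1 \<le> s" and "int s < int n - 1"
    and "only_real_roots (assoc_poly s \<alpha>)"
    and "proots (assoc_poly s \<alpha>) = image_mset (\<lambda>j. - \<beta> j) (mset_set {1..s})"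
    and "k \<in> {int s + 1..int n - 1}"
  shows "(S_mean n s \<alpha> x k)\<^sup>2 \<ge> S_mean n s \<alpha> x (k - 1) * S_mean n s \<alpha> x (k + 1)
    \<and> (\<not> (\<exists>c. card {i \<in> {1..n}. x i = c} + card {j \<in> {1..s}. - \<beta> j = c} \<ge> n)
       \<and> \<not> ((S_mean n s \<alpha> x k)\<^sup>2 = 0 \<and> S_mean n s \<alpha> x (k - 1) * S_mean n s \<alpha> x (k + 1) = 0)
       \<longrightarrow> (S_mean n s \<alpha> x k)\<^sup>2 > S_mean n s \<alpha> x (k - 1) * S_mean n s \<alpha> x (k + 1))"
proof -
  define E where "E i = elem_mean n x (int i)" for i
  define t where "t = nat (k - 1 - int s)"
  define e where "e = nat (int n - 1 - k)"
  define B where "B = image_mset \<beta> (mset_set {1..s})"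
  \<comment> \<open>The derivatives in the direction \<open>(0, 1)\<close> are those for \<open>\<beta> = 0\<close>.\<close>
  define R where "R = replicate_mset t 0 + B"
  define c where "c = shift_act (\<Prod>b\<in>#R. [:b, 1:]) E"
  have k: "k = int (1 + t + s)" and n: "n = 2 + e + size R"
    using assms(5) by (auto simp: t_def e_def R_def B_def)
  have f: "assoc_poly s \<alpha> = (\<Prod>b\<in>#B. [:b, 1:])"
    using monic_eq_prod_proots[of "assoc_poly s \<alpha>"]
    by (simp add: assms(4) degree_assoc_poly coeff_assoc_poly B_def image_mset.compositionality o_def)
  have c: "c i = S_mean n s \<alpha> x (int (i + t + s))" for i
    using shift_act_assoc_poly[of s \<alpha> n x "i + t"] shift_act_power[of t "assoc_poly s \<alpha>" E i]
    by (simp add: c_def R_def f E_def[abs_def])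
  have S: "S_mean n s \<alpha> x (k - 1) = c 0" "S_mean n s \<alpha> x k = c 1" "S_mean n s \<alpha> x (k + 1) = c 2"
    by (simp_all add: c k add_ac)
  have P: "binomial_form n E = (\<Prod>i\<in>{1..n}. [:of_real (x i), 1:])"
    unfolding E_def by (rule binomial_form_elem_mean)
  have "real_rooted (binomial_form n E)"
    unfolding P real_rooted_def by (auto simp: poly_prod add_eq_0_iff)
  then have rr: "real_rooted (binomial_form (2 + e + size R) E)"
    unfolding n .
  have rr': "real_rooted (binomial_form (2 + e) c)"
    unfolding c_def by (rule binomial_form_shift_act(1)[OF rr])
  have rr2: "real_rooted (binomial_form 2 c)"
    by (rule binomial_form_truncate(1)[OF rr'])
  have all_equal: "\<exists>v. card {i \<in> {1..n}. x i = v} + card {j \<in> {1..s}. - \<beta> j = v} \<ge> n"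
    if eq: "c 0 * c 2 = (c 1)\<^sup>2" and nz: "c 1 \<noteq> 0"
  proof -
    \<comment> \<open>The double root; \<open>r \<noteq> 0\<close> because otherwise both sides of the inequality are zero.\<close>
    define r where "r = - c 1 / c 0"
    have c0: "c 0 \<noteq> 0" using that by auto
    then have r: "r \<noteq> 0" using nz by (simp add: r_def)
    have dvd2: "[:- of_real r, 1:] ^ 2 dvd binomial_form 2 c"
      using quadratic_form_discriminant(2)[OF rr2 eq c0] by (simp add: r_def)
    have nz2: "binomial_form 2 c \<noteq> 0"
      using coeff_binomial_form[of 2 c 2] c0 by auto
    have dvd: "[:- of_real r, 1:] ^ (2 + e) dvd binomial_form (2 + e) c"
      by (rule binomial_form_truncate(2)[OF rr' nz2 _ dvd2]) simp
    have nz': "binomial_form (2 + e) c \<noteq> 0"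
      using coeff_binomial_form[of "2 + e" c "2 + e"] c0 by auto
    have "[:- of_real r, 1:] ^ (2 + e + size {#b \<in># R. b \<noteq> r#}) dvd binomial_form n E"
      unfolding n by (rule binomial_form_shift_act(2)[OF rr nz'[unfolded c_def] _ dvd[unfolded c_def]]) simp
    then have 1: "2 + e + size {#b \<in># R. b \<noteq> r#} \<le> card {i \<in> {1..n}. x i = - r}"
      unfolding P by (rule linear_power_dvd_prod_imp_card) simp
    have 2: "size {#b \<in># R. b \<noteq> r#} + size {#b \<in># R. b = r#} = size R"
      using multiset_partition[of R "\<lambda>b. b = r"] by (metis add.commute size_union)
    have "{#b \<in># R. b = r#} = image_mset \<beta> (mset_set {j \<in> {1..s}. \<beta> j = r})"
      using r by (simp add: R_def B_def filter_mset_image_mset)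
    then have 3: "size {#b \<in># R. b = r#} = card {j \<in> {1..s}. - \<beta> j = - r}"
      by simp
    have "n \<le> card {i \<in> {1..n}. x i = - r} + card {j \<in> {1..s}. - \<beta> j = - r}"
      using 1 2 3 n by linarith
    then show ?thesis by blast
  qed
  show ?thesis
    unfolding S using quadratic_form_discriminant(1)[OF rr2] all_equal
    by (metis order_le_less power_zero_numeral)
qed

end
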